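(* Let $f(\boldsymbol{x};\boldsymbol{\theta})$ be a neural network with parameters $\boldsymbol{\theta}\in\mathbb{R}^p$ and inputs $\boldsymbol{x}\in\mathcal{X}$, let $\mathcal{L}(\boldsymbol{\theta};\boldsymbol{z})\in\mathbb{R}$ be a loss function for data points $\boldsymbol{z}=(\boldsymbol{x},y)\in\mathcal{X}\times\mathcal{Y}$, and let $\mathcal{D}\subseteq\mathcal{X}\times\mathcal{Y}$ be a dataset. Suppose that there are constants $G>0$ and $L>0$ such that: (A1) for all $\boldsymbol{z}=(\boldsymbol{x},y),\ \boldsymbol{z}'=(\boldsymbol{x}',y')\in\mathcal{X}\times\mathcal{Y}$ and all $\boldsymbol{\theta}\in\mathbb{R}^p$, $\ \|\nabla_{\boldsymbol{\theta}}\mathcal{L}(\boldsymbol{\theta};\boldsymbol{z})-\nabla_{\boldsymbol{\theta}}\mathcal{L}(\boldsymbol{\theta};\boldsymbol{z}')\|\le G\,\|\boldsymbol{x}-\boldsymbol{x}'\|$; (A2) for all $\boldsymbol{\theta},\boldsymbol{\theta}'\in\mathbb{R}^p$ and all $\boldsymbol{x}\in\mathcal{X}$, $\ \|f(\boldsymbol{x};\boldsymbol{\theta})-f(\boldsymbol{x};\boldsymbol{\theta}')\|\le L\,\|\boldsymbol{\theta}-\boldsymbol{\theta}'\|$. Let $\boldsymbol{\theta}\in\mathbb{R}^p$ be any initialization and let $\eta>0$. For any prompt $\boldsymbol{x}^\star\in\mathcal{X}$ and any $N\ge 1$, let $\mathcal{D}_{\boldsymbol{x}^\star}=\{\boldsymbol{z}_1,\dots,\boldsymbol{z}_N\}\subseteq\mathcal{D}$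 be the set of the $N$ nearest neighbors to $\boldsymbol{\phi}(\boldsymbol{x}^\star)$ in $\mathcal{D}$, and let $\boldsymbol{\theta}_{\boldsymbol{x}^\star}$ be the parameters obtained from $\boldsymbol{\theta}$ by a single gradient descent step with step size $\eta$ on $\mathcal{D}_{\boldsymbol{x}^\star}$: $$\boldsymbol{\theta}_{\boldsymbol{x}^\star}=\boldsymbol{\theta}-\eta\left[\frac1N\sum_{i=1}^N\nabla_{\boldsymbol{\theta}}\mathcal{L}(\boldsymbol{\theta};\boldsymbol{z}_i)\right].$$ Let $\mathcal{D}'=\{\boldsymbol{z}_1',\dots,\boldsymbol{z}_M'\}\subseteq\mathcal{D}$ be any dataset of size $M\ge 1$, and let $\boldsymbol{\theta}'$ be the parameters obtained from the same $\boldsymbol{\theta}$ by a single gradient descent step with step size $\eta$ on $\mathcal{D}'$: $$\boldsymbol{\theta}'=\boldsymbol{\theta}-\eta\left[\frac1M\sum_{j=1}^M\nabla_{\boldsymbol{\theta}}\mathcal{L}(\boldsymbol{\theta};\boldsymbol{z}_j')\right].$$ If $\mathcal{D}'\cap\mathcal{D}_{\boldsymbol{x}^\star}\neq\emptyset$, then $$\|f(\boldsymbol{x}^\star;\boldsymbol{\theta}_{\boldsymbol{x}^\star})-f(\boldsymbol{x}^\star;\boldsymbol{\theta}')\|\le \eta L G\,\bigl(\operatorname{diam}(\mathcal{D}_{\boldsymbol{x}^\star})+\operatorname{diam}(\mathcal{D}')\bigr).$$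
   Context: $\mathcal{X}$ is the input domain, regarded as a subset of a normed space, so that $\|\boldsymbol{x}-\boldsymbol{x}'\|$ makes sense for $\boldsymbol{x},\boldsymbol{x}'\in\mathcal{X}$; $\mathcal{Y}$ is an arbitrary set of outputs (labels). The network $f(\cdot;\boldsymbol{\theta})$ takes values in a normed space; $\mathcal{L}(\cdot;\boldsymbol{z})$ is differentiable in $\boldsymbol{\theta}$ for each $\boldsymbol{z}$, and $\nabla_{\boldsymbol{\theta}}$ denotes its gradient in $\boldsymbol{\theta}$. On $\mathbb{R}^p$ the norm $\|\cdot\|$ is the same one in (A1) (for gradients) and in (A2) (for parameters). $\boldsymbol{\phi}$ is a fixed embedding map sending each input $\boldsymbol{x}\in\mathcal{X}$ to a normalized (unit-norm) vector $\boldsymbol{\phi}(\boldsymbol{x})\in\mathbb{R}^d$. The $N$ nearest neighbors to $\boldsymbol{\phi}(\boldsymbol{x}^\star)$ in $\mathcal{D}$ are $N$ distinct data points $(\boldsymbol{x},y)\in\mathcal{D}$ whose input embeddings $\boldsymbol{\phi}(\boldsymbol{x})$ have the smallest distances to $\boldsymbol{\phi}(\boldsymbol{x}^\star)$ (ties broken arbitrarily; $\mathcal{D}$ is finite with at least $N$ elements). For a finite set $S\subseteq\mathcal{X}\times\mathcal{Y}$ of data points, $\operatorname{diam}(S)=\max\{\|\boldsymbol{x}-\boldsymbol{x}'\| : (\boldsymbol{x},y),(\boldsymbol{x}',y')\in S\}$ is the diameter of its set of inputs. *)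

theory Defs
  imports "HOL-Analysis.Analysis"
begin

text \<open>
  The type class norm on \<^typ>\<open>real ^ 'n\<close> is the Euclidean one. An arbitrary norm on that
  space is a function satisfying the norm axioms.
\<close>

definition is_norm :: "('v::real_vector \<Rightarrow> real) \<Rightarrow> bool" where
  "is_norm \<nu> \<longleftrightarrow>
     (\<forall>v. 0 \<le> \<nu> v) \<and>
     (\<forall>v. \<nu> v = 0 \<longleftrightarrow> v = 0) \<and>
     (\<forall>c v. \<nu> (c *\<^sub>R v) = \<bar>c\<bar> * \<nu> v) \<and>
     (\<forall>v w. \<nu> (v + w) \<le> \<nu> v + \<nu> w)"

lemma is_norm_norm: "is_norm (norm :: 'v::real_normed_vector \<Rightarrow> real)"
  by (simp add: is_norm_def norm_triangle_ineq)

text \<open>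
  The value is meaningful only where \<open>F\<close> is differentiable. The inner product is the standard
  one, so this is the vector of partial derivatives whatever norm is used on the space.
\<close>

definition gradient :: "(real ^ 'n \<Rightarrow> real) \<Rightarrow> real ^ 'n \<Rightarrow> real ^ 'n" where
  "gradient F x = (THE g. GDERIV F x :> g)"

lemma gradient_eqI:
  assumes "GDERIV F x :> g"
  shows "gradient F x = g"
  unfolding gradient_def
proof (rule the_equality)
  show "GDERIV F x :> g" by fact
next
  fix g' assume "GDERIV F x :> g'"
  with assms have "(\<lambda>h. h \<bullet> g') = (\<lambda>h. h \<bullet> g)"
    unfolding gderiv_def by (rule has_derivative_unique[rotated])
  then show "g' = g"
    unfolding fun_eq_iff by (simp only: vector_eq_ldot)
qed

lemma GDERIV_gradient:
  assumes "F differentiable (at x)"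
  shows "GDERIV F x :> gradient F x"
proof -
  obtain F' where F': "(F has_derivative F') (at x)"
    using assms by (auto simp: differentiable_def)
  then interpret F': bounded_linear F'
    by (rule has_derivative_bounded_linear)
  have "F' = (\<lambda>h. h \<bullet> adjoint F' 1)"
    using adjoint_works[OF F'.linear_axioms, of _ 1] by (simp add: fun_eq_iff)
  then have "GDERIV F x :> adjoint F' 1"
    using F' by (simp add: gderiv_def)
  then show ?thesis
    by (simp only: gradient_eqI)
qed

text \<open>
  \<open>S\<close> is a possible set of the \<open>N\<close> nearest neighbors to \<open>q\<close> in \<open>D\<close>. Ties leave several such
  sets, whence a predicate. Distinct data points may share the same input.
\<close>

definition nearest_neighbors ::
  "('x \<Rightarrow> 'e::metric_space) \<Rightarrow> 'e \<Rightarrow> ('x \<times> 'y) set \<Rightarrow> nat \<Rightarrow> ('x \<times> 'y) set \<Rightarrow> bool" where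
  "nearest_neighbors \<phi> q D N S \<longleftrightarrow>
     S \<subseteq> D \<and> finite S \<and> card S = N \<and>
     (\<forall>z\<in>S. \<forall>w\<in>D - S. dist (\<phi> (fst z)) q \<le> dist (\<phi> (fst w)) q)"

definition data_diam :: "('x::real_normed_vector \<times> 'y) set \<Rightarrow> real" where
  "data_diam S = diameter (fst ` S)"

lemma data_diam_eq_Max:
  assumes "finite S" "S \<noteq> {}"
  shows "data_diam S = Max {norm (x - x') | x x' y y'. (x, y) \<in> S \<and> (x', y') \<in> S}"
proof -
  have eq: "{norm (x - x') | x x' y y'. (x, y) \<in> S \<and> (x', y') \<in> S}
      = (\<lambda>(x, x'). dist x x') ` (fst ` S \<times> fst ` S)"
  proof (intro equalityI subsetI)
    fix r assume "r \<in> {norm (x - x') | x x' y y'. (x, y) \<in> S \<and> (x', y') \<in> S}"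
    then obtain x x' y y' where *: "r = dist x x'" "(x, y) \<in> S" "(x', y') \<in> S"
      unfolding dist_norm by blast
    then have "(x, x') \<in> fst ` S \<times> fst ` S"
      by (metis SigmaI fst_conv imageI)
    with * show "r \<in> (\<lambda>(x, x'). dist x x') ` (fst ` S \<times> fst ` S)"
      by (metis (no_types, lifting) case_prod_conv imageI)
  next
    fix r assume "r \<in> (\<lambda>(x, x'). dist x x') ` (fst ` S \<times> fst ` S)"
    then obtain z z' where "z \<in> S" "z' \<in> S" "r = norm (fst z - fst z')"
      unfolding dist_norm by auto
    then show "r \<in> {norm (x - x') | x x' y y'. (x, y) \<in> S \<and> (x', y') \<in> S}"
      by (metis (mono_tags, lifting) mem_Collect_eq prod.collapse)
  qed
  show ?thesis
    unfolding data_diam_def diameter_def eq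
    using assms by (simp add: cSup_eq_Max)
qed

end

theory Submission
  imports Defs
begin

text \<open>
  On a data set containing \<open>z\<^sub>0\<close>, the mean gradient lies within \<open>G\<close> times the diameter of the
  gradient at \<open>z\<^sub>0\<close>. Comparing both mean gradients with the gradient at a common point bounds the
  distance of the two updated parameters, and the Lipschitz condition on \<open>f\<close> transfers this bound
  to the outputs.
\<close>

lemma is_norm_minus_commute:
  assumes "is_norm \<nu>"
  shows "\<nu> (v - w) = \<nu> (w - v)"
proof -
  have "\<nu> ((-1) *\<^sub>R (w - v)) = \<bar>-1\<bar> * \<nu> (w - v)"
    using assms unfolding is_norm_def by blast
  then show ?thesis by simp
qed

lemma is_norm_sum_le:
  assumes "is_norm \<nu>"
  shows "\<nu> (sum g S) \<le> (\<Sum>z\<in>S. \<nu> (g z))"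
proof -
  \<comment> \<open>This settles the empty set and also an infinite \<open>S\<close>, where both
    sums are 0 by convention.\<close>
  have [simp]: "\<nu> 0 = 0"
    using assms unfolding is_norm_def by blast
  show ?thesis
  proof (induction S rule: infinite_finite_induct)
    case (insert x F)
    have "\<nu> (g x + sum g F) \<le> \<nu> (g x) + \<nu> (sum g F)"
      using assms by (simp add: is_norm_def)
    with insert show ?case by simp
  qed simp_all
qed

text \<open>Balls of \<open>\<nu>\<close> are convex. Concretely, the mean minus \<open>c\<close> is
  the mean of the differences \<open>g z - c\<close>, to which homogeneity and the triangle
  inequality apply.\<close>

lemma is_norm_mean_diff_le:
  assumes \<nu>: "is_norm \<nu>" and S: "finite S" "S \<noteq> {}"
    and B: "\<And>z. z \<in> S \<Longrightarrow> \<nu> (g z - c) \<le> B"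
  shows "\<nu> ((1 / real (card S)) *\<^sub>R sum g S - c) \<le> B"
proof -
  let ?n = "real (card S)"
  have n: "?n > 0"
    using S by (simp add: card_gt_0_iff)
  \<comment> \<open>Here \<open>c\<close> is written as the mean of \<open>card S\<close> copies of
    itself, which requires \<open>card S\<close> to be nonzero.\<close>
  have "(1 / ?n) *\<^sub>R sum g S - c = (1 / ?n) *\<^sub>R (\<Sum>z\<in>S. g z - c)"
    using n by (simp add: sum_subtractf scaleR_diff_right sum_constant_scaleR)
  moreover have "\<nu> ((1 / ?n) *\<^sub>R (\<Sum>z\<in>S. g z - c)) = (1 / ?n) * \<nu> (\<Sum>z\<in>S. g z - c)"
    using \<nu> by (simp add: is_norm_def)
  moreover have "\<nu> (\<Sum>z\<in>S. g z - c) \<le> ?n * B"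
    using is_norm_sum_le[OF \<nu>, of "\<lambda>z. g z - c" S] sum_bounded_above[of S "\<lambda>z. \<nu> (g z - c)" B] B
    by simp
  ultimately show ?thesis
    using n by (simp add: pos_divide_le_eq mult.commute)
qed

text \<open>Since \<open>diameter\<close> is a supremum, bounding distances by it calls for a
  bounded set of inputs; finiteness of \<open>S\<close> supplies this.\<close>

lemma norm_diff_le_data_diam:
  assumes "finite S" "z \<in> S" "w \<in> S"
  shows "norm (fst z - fst w) \<le> data_diam S"
  using assms unfolding data_diam_def
  by (metis diameter_bounded_bound dist_norm finite_imageI finite_imp_bounded imageI)

theorem propositionC1:
  fixes X :: "'x::real_normed_vector set"
    and Y :: "'y set"
    and f :: "'x \<Rightarrow> real ^ 'p \<Rightarrow> 'o::real_normed_vector"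
    and Loss :: "real ^ 'p \<Rightarrow> 'x \<times> 'y \<Rightarrow> real"
    and \<nu> :: "real ^ 'p \<Rightarrow> real"
    and \<phi> :: "'x \<Rightarrow> real ^ 'd"
    and D Dstar D' :: "('x \<times> 'y) set"
    and G L \<eta> :: real
    and \<theta> \<theta>star \<theta>' :: "real ^ 'p"
    and xstar :: 'x
    and N M :: nat
  assumes norm: "is_norm \<nu>"
    and Loss_diff: "\<And>z t. z \<in> X \<times> Y \<Longrightarrow> (\<lambda>s. Loss s z) differentiable (at t)"
    and phi_unit: "\<And>x. x \<in> X \<Longrightarrow> norm (\<phi> x) = 1"
    and D: "D \<subseteq> X \<times> Y" "finite D"
    and G_pos: "G > 0"
    and L_pos: "L > 0"
    and A1: "\<And>x y x' y' t. (x, y) \<in> X \<times> Y \<Longrightarrow> (x', y') \<in> X \<times> Y \<Longrightarrow>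
               \<nu> (gradient (\<lambda>s. Loss s (x, y)) t - gradient (\<lambda>s. Loss s (x', y')) t)
                 \<le> G * norm (x - x')"
    and A2: "\<And>t t' x. x \<in> X \<Longrightarrow> norm (f x t - f x t') \<le> L * \<nu> (t - t')"
    and eta_pos: "\<eta> > 0"
    and xstar: "xstar \<in> X"
    and N: "1 \<le> N" "N \<le> card D"
    and Dstar: "nearest_neighbors \<phi> (\<phi> xstar) D N Dstar"
    and theta_star: "\<theta>star = \<theta> - \<eta> *\<^sub>R ((1 / real N) *\<^sub>R (\<Sum>z\<in>Dstar. gradient (\<lambda>s. Loss s z) \<theta>))"
    and D': "D' \<subseteq> D" "card D' = M" "1 \<le> M"
    and theta': "\<theta>' = \<theta> - \<eta> *\<^sub>R ((1 / real M) *\<^sub>R (\<Sum>z\<in>D'. gradient (\<lambda>s. Loss s z) \<theta>))"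
    and overlap: "D' \<inter> Dstar \<noteq> {}"
  shows "norm (f xstar \<theta>star - f xstar \<theta>') \<le> \<eta> * L * G * (data_diam Dstar + data_diam D')"
proof -
  define g where "g z = gradient (\<lambda>s. Loss s z) \<theta>" for z
  \<comment> \<open>Dividing by \<open>card S\<close> instead of \<open>N\<close> or
    \<open>M\<close> lets a single estimate serve both data sets.\<close>
  define m where "m S = (1 / real (card S)) *\<^sub>R sum g S" for S
  obtain z0 where z0: "z0 \<in> D'" "z0 \<in> Dstar"
    using overlap by blast
  \<comment> \<open>The overlap is what allows the same reference gradient \<open>g z0\<close> for
    \<open>Dstar\<close> and for \<open>D'\<close>.\<close>
  have mean: "\<nu> (m S - g z0) \<le> G * data_diam S" if S: "S \<subseteq> D" "z0 \<in> S" for S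
    unfolding m_def
  proof (rule is_norm_mean_diff_le[OF norm])
    show fin: "finite S"
      using S D(2) finite_subset by blast
    show "S \<noteq> {}"
      using S by blast
    fix z assume z: "z \<in> S"
    have "z \<in> X \<times> Y" "z0 \<in> X \<times> Y"
      using z S D(1) by auto
    then have "\<nu> (g z - g z0) \<le> G * norm (fst z - fst z0)"
      using A1[of "fst z" "snd z" "fst z0" "snd z0" \<theta>] by (simp add: g_def)
    also have "\<dots> \<le> G * data_diam S"
      using norm_diff_le_data_diam[OF fin z S(2)] G_pos by simp
    finally show "\<nu> (g z - g z0) \<le> G * data_diam S" .
  qed
  have "Dstar \<subseteq> D" and cardD: "card Dstar = N"
    using Dstar by (auto simp: nearest_neighbors_def)
  then have star: "\<nu> (g z0 - m Dstar) \<le> G * data_diam Dstar"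
    using mean z0 is_norm_minus_commute[OF norm] by metis
  \<comment> \<open>The common start \<theta> cancels, the minus sign of the descent step puts
    \<open>m D'\<close> first, and \<open>g z0\<close> is inserted to split the difference of
    means.\<close>
  have "\<theta>star - \<theta>' = \<eta> *\<^sub>R ((m D' - g z0) + (g z0 - m Dstar))"
    unfolding theta_star theta' m_def cardD D'(2) g_def by (simp add: scaleR_diff_right)
  \<comment> \<open>Homogeneity of \<open>\<nu>\<close> yields the factor
    \<open>\<bar>\<eta>\<bar>\<close>, which is \<eta> by positivity.\<close>
  then have "\<nu> (\<theta>star - \<theta>') = \<eta> * \<nu> ((m D' - g z0) + (g z0 - m Dstar))"
    using norm eta_pos unfolding is_norm_def by (metis abs_of_pos)
  also have "\<dots> \<le> \<eta> * (\<nu> (m D' - g z0) + \<nu> (g z0 - m Dstar))"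
    using norm eta_pos unfolding is_norm_def by (meson less_imp_le mult_left_mono)
  also have "\<dots> \<le> \<eta> * (G * data_diam D' + G * data_diam Dstar)"
    using mean[OF D'(1) z0(1)] star eta_pos by (intro mult_left_mono) auto
  finally have "L * \<nu> (\<theta>star - \<theta>') \<le> L * (\<eta> * (G * data_diam D' + G * data_diam Dstar))"
    using L_pos by simp
  with A2[OF xstar, of \<theta>star \<theta>'] show ?thesis
    by (simp add: algebra_simps)
qed

end
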